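(* As formal power series in $q$ with coefficients polynomials in $z$: $$\sum_{\lambda\in\mathcal{P}_1}z^{a(\lambda)}q^{|\lambda|}=1+\sum_{n=1}^{\infty}\frac{q^{4n}(-zq;q^8)_{n}(-z^3q^5;q^8)_{n-1}(1+z^3q^{4n-3})}{(q^4;q^4)_{n}(z^2q^2;q^4)_{n}}+\sum_{n=0}^{\infty}\frac{z^2q^{4n+2}(-zq;q^8)_{n}(-z^3q^5;q^8)_{n}(1+z^{-1}q^{4n-1})}{(q^4;q^4)_{n}(z^2q^2;q^4)_{n+1}}=\frac{(-zq;q^8)_{\infty}(-z^3q^5;q^8)_{\infty}}{(z^2q^2;q^4)_{\infty}(q^4;q^4)_{\infty}},$$ $$\sum_{\lambda\in\mathcal{P}_2}z^{a(\lambda)}q^{|\lambda|}=1+\sum_{n=1}^{\infty}\frac{q^{4n}(-z^3q^3;q^8)_{n}(-zq^7;q^8)_{n-1}(1+zq^{4n-1})}{(q^4;q^4)_{n}(z^2q^2;q^4)_{n}}+\sum_{n=0}^{\infty}\frac{z^2q^{4n+2}(-z^3q^3;q^8)_{n}(-zq^7;q^8)_{n}(1+zq^{4n+1})}{(q^4;q^4)_{n}(z^2q^2;q^4)_{n+1}}=\frac{(-z^3q^3;q^8)_{\infty}(-zq^7;q^8)_{\infty}}{(z^2q^2;q^4)_{\infty}(q^4;q^4)_{\infty}},$$ $$\sum_{\lambda\in\mathcal{P}_1}z^{a(\lambda)}q^{S(\lambda)}=1+\sum_{n=1}^{\infty}\frac{q^{2n}(-zq;q^4)_{n}(-z^3q^4;q^4)_{n-1}(1+z^3q^{2n})}{(q^2;q^2)_{n}(z^2q^2;q^2)_{n}}+\sum_{n=0}^{\infty}\frac{z^2q^{2n+2}(-zq;q^4)_{n}(-z^3q^4;q^4)_{n}(1+z^{-1}q^{2n-1})}{(q^2;q^2)_{n}(z^2q^2;q^2)_{n+1}}=\frac{(-zq;q^4)_{\infty}(-z^3q^4;q^4)_{\infty}}{(z^2q^2;q^2)_{\infty}(q^2;q^2)_{\infty}},$$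 $$\sum_{\lambda\in\mathcal{P}_2}z^{a(\lambda)}q^{S(\lambda)}=1+\sum_{n=1}^{\infty}\frac{q^{2n}(-z^3q^3;q^4)_{n}(-zq^4;q^4)_{n-1}(1+zq^{2n})}{(q^2;q^2)_{n}(z^2q^2;q^2)_{n}}+\sum_{n=0}^{\infty}\frac{z^2q^{2n+2}(-z^3q^3;q^4)_{n}(-zq^4;q^4)_{n}(1+zq^{2n+1})}{(q^2;q^2)_{n}(z^2q^2;q^2)_{n+1}}=\frac{(-z^3q^3;q^4)_{\infty}(-zq^4;q^4)_{\infty}}{(z^2q^2;q^2)_{\infty}(q^2;q^2)_{\infty}}.$$
   Context: A partition is a finite weakly decreasing sequence of positive integers $\lambda=(\lambda_1,\ldots,\lambda_\ell)$ (the empty partition is included), of length $\ell(\lambda)=\ell$ and weight $|\lambda|=\lambda_1+\cdots+\lambda_\ell$. The alternating sum is $a(\lambda)=\lambda_1-\lambda_2+\lambda_3-\cdots+(-1)^{\ell-1}\lambda_\ell$ and the Schmidt weight is $S(\lambda)=\lambda_1+\lambda_3+\lambda_5+\cdots$ (the sum of the odd-indexed parts). $\mathcal{P}_1$ is the set of partitions such that for all $1\le i<\ell(\lambda)$, $\lambda_i-\lambda_{i+1}\geq3$ if $\lambda_{i+1}$ is odd. $\mathcal{P}_2$ is the set of partitions with all parts at least $2$ such that for all $1\le i<\ell(\lambda)$, $\lambda_i-\lambda_{i+1}\geq3$ if $\lambda_i$ is odd. Both contain the empty partition. Notation: $(a;q)_0=1$, $(a;q)_n=\prod_{i=0}^{n-1}(1-aq^i)$,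 $(a;q)_\infty=\lim_{n\to\infty}(a;q)_n$. Negative powers of $q$ and $z$ cancel against the monomial prefactors. *)

theory Defs
  imports
    "HOL-Analysis.Analysis"
    "HOL-Computational_Algebra.Computational_Algebra"
begin

definition is_partition :: "nat list \<Rightarrow> bool" where
  "is_partition l \<longleftrightarrow> sorted_wrt (\<ge>) l \<and> (\<forall>x\<in>set l. x > 0)"

text \<open>List indices start at 0, so the part \<open>\<lambda>\<^sub>i\<close> is \<open>l ! (i - 1)\<close>; the odd-indexed parts
  are the entries of \<open>l\<close> at even list positions.\<close>

definition alt_sum :: "nat list \<Rightarrow> int" where
  "alt_sum l = (\<Sum>i<length l. (- 1) ^ i * int (l ! i))"

definition schmidt_weight :: "nat list \<Rightarrow> nat" where
  "schmidt_weight l = (\<Sum>i | i < length l \<and> even i. l ! i)"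

definition P1 :: "nat list set" where
  "P1 = {l. is_partition l \<and>
     (\<forall>i. i + 1 < length l \<longrightarrow> odd (l ! (i + 1)) \<longrightarrow> int (l ! i) - int (l ! (i + 1)) \<ge> 3)}"

definition P2 :: "nat list set" where
  "P2 = {l. is_partition l \<and> (\<forall>x\<in>set l. x \<ge> 2) \<and>
     (\<forall>i. i + 1 < length l \<longrightarrow> odd (l ! i) \<longrightarrow> int (l ! i) - int (l ! (i + 1)) \<ge> 3)}"

lemma alt_sum_Cons: "alt_sum (x # xs) = int x - alt_sum xs"
  unfolding alt_sum_def by (simp add: sum.lessThan_Suc_shift sum_negf del: sum.lessThan_Suc)

text \<open>The exponent \<open>nat (alt_sum l)\<close> does not truncate.\<close>

lemma alt_sum_nonneg:
  assumes "is_partition l"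
  shows "alt_sum l \<ge> 0"
proof -
  have "sorted_wrt (\<ge>) l \<Longrightarrow> 0 \<le> alt_sum l \<and> (l \<noteq> [] \<longrightarrow> alt_sum l \<le> int (hd l))"
  proof (induction l)
    case Nil
    then show ?case by (simp add: alt_sum_def)
  next
    case (Cons x xs)
    then show ?case
      by (cases xs) (auto simp: alt_sum_Cons, simp_all add: alt_sum_def)
  qed
  with assms show ?thesis by (simp add: is_partition_def)
qed

definition qpoch :: "'a::comm_ring_1 \<Rightarrow> 'a \<Rightarrow> nat \<Rightarrow> 'a" where
  "qpoch a q n = (\<Prod>i<n. 1 - a * q ^ i)"

text \<open>The limit is taken in the library's metric on formal power series, i.e. coefficientwise
  (each coefficient is eventually constant).\<close>

definition qpoch_inf :: "'a::comm_ring_1 fps \<Rightarrow> 'a fps \<Rightarrow> 'a fps" where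
  "qpoch_inf a q = lim (\<lambda>n. qpoch a q n)"

lemma qpoch_LIMSEQ:
  fixes a q :: "'a::comm_ring_1 fps"
  assumes "a $ 0 = 0" "q $ 0 = 0"
  shows "(\<lambda>n. qpoch a q n) \<longlonglongrightarrow> qpoch_inf a q"
proof -
  have zero: "(a * q ^ m * f) $ n = 0" if "n \<le> m" for m n f
  proof -
    have "q = fps_X * fps_shift 1 q" "a = fps_X * fps_shift 1 a"
      using assms by (auto intro!: fps_ext simp: fps_X_mult_nth)
    then obtain q' a' where "q = fps_X * q'" "a = fps_X * a'" by blast
    then have "a * q ^ m * f = fps_X ^ Suc m * (a' * q' ^ m * f)"
      by (simp add: power_mult_distrib algebra_simps)
    then show ?thesis
      using that by (simp only: fps_X_power_mult_nth) simp
  qed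
  have step: "qpoch a q (Suc m) $ n = qpoch a q m $ n" if "n \<le> m" for m n
    using zero[OF that, of "qpoch a q m"]
    by (simp add: qpoch_def algebra_simps)
  have stable: "qpoch a q m $ n = qpoch a q n $ n" if "n \<le> m" for m n
    using that by (induction rule: dec_induct) (simp_all add: step)
  have "(\<lambda>n. qpoch a q n) \<longlonglongrightarrow> Abs_fps (\<lambda>n. qpoch a q n $ n)"
    by (rule tendsto_fpsI) (auto simp: eventually_sequentially intro!: stable)
  then show ?thesis
    unfolding qpoch_inf_def by (simp add: limI)
qed

text \<open>The coefficient ring of integer polynomials is not a field, so division of power series is
  not available from the library's \<open>inverse\<close> class. The quotient below is meant for denominators
  with constant coefficient 1, which are units.\<close>

definition fps_quot :: "'a::comm_ring_1 fps \<Rightarrow> 'a fps \<Rightarrow> 'a fps" (infixl \<open>\<oslash>\<close> 70) where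
  "f \<oslash> g = f * fps_right_inverse g 1"

lemma fps_quot_mult:
  fixes f g :: "'a::comm_ring_1 fps"
  assumes "g $ 0 = 1"
  shows "(f \<oslash> g) * g = f"
proof -
  have "g * fps_right_inverse g 1 = 1"
    by (rule fps_right_inverse) (simp add: assms)
  then show ?thesis
    by (metis fps_quot_def mult.assoc mult.commute mult.right_neutral)
qed

end

theory Submission
  imports Defs
begin

text \<open>All four identities have the weight \<open>x ^ a(\<lambda>) * p ^ (\<lambda>\<^sub>2 + \<lambda>\<^sub>4 + \<dots>)\<close>, with \<open>x = z * q\<close> and \<open>p = q\<^sup>2\<close> for
  the size, \<open>p = q\<close> for the Schmidt weight. Let \<open>E\<^sub>i\<close> and \<open>O\<^sub>i\<close> be the generating functions of the
  admissible tails \<open>(\<lambda>\<^sub>i, \<lambda>\<^sub>i\<^sub>+\<^sub>1, \<dots>)\<close> with \<open>\<lambda>\<^sub>i\<close> even and odd, and \<open>c\<^sub>i\<close> the weight of a column of height \<open>i\<close>.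
  Summing over \<open>\<lambda>\<^sub>i - \<lambda>\<^sub>i\<^sub>+\<^sub>1\<close> gives \<open>O\<^sub>i = c\<^sub>i ^ b * E\<^sub>i\<close> and
  \<open>(1 - c\<^sub>i\<^sup>2) * E\<^sub>i = (1 + c\<^sub>i ^ a * c\<^sub>i\<^sub>+\<^sub>1 ^ b) * E\<^sub>i\<^sub>+\<^sub>1\<close>, where \<open>(a, b)\<close> is \<open>(3, 1)\<close> for \<open>P1\<close> and \<open>(1, 3)\<close> for
  \<open>P2\<close>; iterating yields the infinite product. The series telescopes: adding the terms one by one
  turns the partial sums into truncations of the same product.\<close>

unbundle no vec_syntax

section \<open>Coefficientwise summation of formal power series\<close>

text \<open>One finite \<open>F\<close> serves all coefficients up to \<open>n\<close>, so unions,
  reindexings and products of families reduce to finite sums.\<close>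

definition fps_sums :: "('b \<Rightarrow> 'a::comm_ring_1 fps) \<Rightarrow> 'b set \<Rightarrow> 'a fps \<Rightarrow> bool" where
  "fps_sums f A S \<longleftrightarrow> (\<forall>n. \<exists>F\<subseteq>A. finite F \<and> (\<forall>a\<in>A - F. \<forall>k\<le>n. f a $ k = 0) \<and>
     (\<forall>k\<le>n. sum f F $ k = S $ k))"

lemma fps_sumsE:
  assumes "fps_sums f A S"
  obtains F where "F \<subseteq> A" "finite F" "\<And>a k. a \<in> A \<Longrightarrow> a \<notin> F \<Longrightarrow> k \<le> n \<Longrightarrow> f a $ k = 0"
    "\<And>k. k \<le> n \<Longrightarrow> sum f F $ k = S $ k"
  using assms unfolding fps_sums_def by (metis DiffI)

lemma fps_sums_imp_has_sum:
  assumes "fps_sums f A S"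
  shows "(f has_sum S) A"
  unfolding has_sum_def
proof (rule tendsto_fpsI)
  fix n
  obtain F where F: "F \<subseteq> A" "finite F" "\<And>a k. a \<in> A \<Longrightarrow> a \<notin> F \<Longrightarrow> k \<le> n \<Longrightarrow> f a $ k = 0"
    "\<And>k. k \<le> n \<Longrightarrow> sum f F $ k = S $ k"
    using assms by (rule fps_sumsE[where n = n]) (rule that)
  have "sum f G $ n = S $ n" if G: "finite G" "F \<subseteq> G" "G \<subseteq> A" for G
  proof -
    have "(\<Sum>a\<in>G. f a $ n) = (\<Sum>a\<in>F. f a $ n)"
      using G F(3)[OF _ _ order_refl] by (intro sum.mono_neutral_right) auto
    then show ?thesis
      using F(4)[of n] by (simp add: fps_sum_nth)
  qed
  then show "\<forall>\<^sub>F G in finite_subsets_at_top A. sum f G $ n = S $ n"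
    unfolding eventually_finite_subsets_at_top using F(1,2) by blast
qed

lemma fps_sums_imp_infsum: "fps_sums f A S \<Longrightarrow> infsum f A = S"
  by (intro infsumI fps_sums_imp_has_sum)

text \<open>The sum is built diagonally: its coefficient \<open>n\<close> is read off the finite set
  of indices that contribute up to degree \<open>n\<close>, and enlarging that set changes
  nothing.\<close>

lemma fps_sums_infsum:
  fixes f :: "'b \<Rightarrow> 'a::comm_ring_1 fps"
  assumes "\<And>n. finite {a \<in> A. f a $ n \<noteq> 0}"
  shows "fps_sums f A (infsum f A)"
proof -
  define F where "F n = (\<Union>k\<le>n. {a \<in> A. f a $ k \<noteq> 0})" for n
  define S where "S = Abs_fps (\<lambda>n. sum f (F n) $ n)"
  have "sum f (F n) $ k = S $ k" if "k \<le> n" for k n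
  proof -
    have "(\<Sum>a\<in>F n. f a $ k) = (\<Sum>a\<in>F k. f a $ k)"
      using assms that by (intro sum.mono_neutral_right) (fastforce simp: F_def)+
    then show ?thesis
      by (simp add: S_def fps_sum_nth)
  qed
  moreover have "F n \<subseteq> A" "finite (F n)" "\<forall>a\<in>A - F n. \<forall>k\<le>n. f a $ k = 0" for n
    using assms by (auto simp: F_def)
  ultimately have "fps_sums f A S"
    unfolding fps_sums_def by meson
  then show ?thesis
    using fps_sums_imp_infsum by metis
qed

lemma fps_sums_cong:
  assumes "\<And>a. a \<in> A \<Longrightarrow> f a = g a"
  shows "fps_sums f A S \<longleftrightarrow> fps_sums g A S"
proof -
  have "fps_sums g A S" if "fps_sums f A S" "\<And>a. a \<in> A \<Longrightarrow> f a = g a" for f g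
    unfolding fps_sums_def
  proof
    fix n
    obtain F where "F \<subseteq> A" "finite F" "\<And>a k. a \<in> A \<Longrightarrow> a \<notin> F \<Longrightarrow> k \<le> n \<Longrightarrow> f a $ k = 0"
      "\<And>k. k \<le> n \<Longrightarrow> sum f F $ k = S $ k"
      using \<open>fps_sums f A S\<close> by (rule fps_sumsE[where n = n]) blast
    moreover have "sum g F = sum f F"
      using that(2) \<open>F \<subseteq> A\<close> by (intro sum.cong) auto
    ultimately show "\<exists>F\<subseteq>A. finite F \<and> (\<forall>a\<in>A - F. \<forall>k\<le>n. g a $ k = 0) \<and>
        (\<forall>k\<le>n. sum g F $ k = S $ k)"
      using that(2) by (intro exI[of _ F]) auto
  qed
  from this[of f g] this[of g f] show ?thesis
    using assms by auto
qed

lemma fps_sums_reindex: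
  assumes "inj_on h A" "fps_sums (\<lambda>a. f (h a)) A S"
  shows "fps_sums f (h ` A) S"
  unfolding fps_sums_def
proof
  fix n
  obtain F where F: "F \<subseteq> A" "finite F" "\<And>a k. a \<in> A \<Longrightarrow> a \<notin> F \<Longrightarrow> k \<le> n \<Longrightarrow> f (h a) $ k = 0"
    "\<And>k. k \<le> n \<Longrightarrow> (\<Sum>a\<in>F. f (h a)) $ k = S $ k"
    using assms(2) by (rule fps_sumsE[where n = n]) (rule that)
  have "sum f (h ` F) = (\<Sum>a\<in>F. f (h a))"
    using sum.reindex[OF inj_on_subset[OF assms(1) F(1)]] by simp
  then show "\<exists>F\<subseteq>h ` A. finite F \<and> (\<forall>a\<in>h ` A - F. \<forall>k\<le>n. f a $ k = 0) \<and>
      (\<forall>k\<le>n. sum f F $ k = S $ k)"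
    using F by (intro exI[of _ "h ` F"]) (auto intro!: F(3))
qed

lemma fps_sums_Un_disjoint:
  assumes "fps_sums f A S" "fps_sums f B T" "A \<inter> B = {}"
  shows "fps_sums f (A \<union> B) (S + T)"
  unfolding fps_sums_def
proof
  fix n
  obtain F where F: "F \<subseteq> A" "finite F" "\<And>a k. a \<in> A \<Longrightarrow> a \<notin> F \<Longrightarrow> k \<le> n \<Longrightarrow> f a $ k = 0"
    "\<And>k. k \<le> n \<Longrightarrow> sum f F $ k = S $ k"
    using assms(1) by (rule fps_sumsE[where n = n]) (rule that)
  obtain G where G: "G \<subseteq> B" "finite G" "\<And>a k. a \<in> B \<Longrightarrow> a \<notin> G \<Longrightarrow> k \<le> n \<Longrightarrow> f a $ k = 0"
    "\<And>k. k \<le> n \<Longrightarrow> sum f G $ k = T $ k"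
    using assms(2) by (rule fps_sumsE[where n = n]) (rule that)
  have "sum f (F \<union> G) = sum f F + sum f G"
    using F G assms(3) by (intro sum.union_disjoint) auto
  then show "\<exists>F\<subseteq>A \<union> B. finite F \<and> (\<forall>a\<in>A \<union> B - F. \<forall>k\<le>n. f a $ k = 0) \<and>
      (\<forall>k\<le>n. sum f F $ k = (S + T) $ k)"
    using F G by (intro exI[of _ "F \<union> G"]) auto
qed

text \<open>Coefficients up to \<open>n\<close> of \<open>f a * g b\<close> involve only
  coefficients up to \<open>n\<close> of the factors, so they vanish outside the rectangle
  \<open>F \<times> G\<close>.\<close>

lemma fps_sums_mult:
  assumes "fps_sums f A S" "fps_sums g B T"
  shows "fps_sums (\<lambda>(a, b). f a * g b) (A \<times> B) (S * T)"
  unfolding fps_sums_def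
proof
  fix n
  obtain F where F: "F \<subseteq> A" "finite F" "\<And>a k. a \<in> A \<Longrightarrow> a \<notin> F \<Longrightarrow> k \<le> n \<Longrightarrow> f a $ k = 0"
    "\<And>k. k \<le> n \<Longrightarrow> sum f F $ k = S $ k"
    using assms(1) by (rule fps_sumsE[where n = n]) (rule that)
  obtain G where G: "G \<subseteq> B" "finite G" "\<And>a k. a \<in> B \<Longrightarrow> a \<notin> G \<Longrightarrow> k \<le> n \<Longrightarrow> g a $ k = 0"
    "\<And>k. k \<le> n \<Longrightarrow> sum g G $ k = T $ k"
    using assms(2) by (rule fps_sumsE[where n = n]) (rule that)
  have "(\<Sum>(a, b)\<in>F \<times> G. f a * g b) = sum f F * sum g G"
    by (simp add: sum_product sum.cartesian_product)
  then have "(\<Sum>(a, b)\<in>F \<times> G. f a * g b) $ k = (S * T) $ k" if "k \<le> n" for k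
    using that F(4) G(4) by (simp add: fps_mult_nth)
  moreover have "(f a * g b) $ k = 0" if "(a, b) \<in> A \<times> B - F \<times> G" "k \<le> n" for a b k
    using that F(3)[of a] G(3)[of b] by (auto simp: fps_mult_nth intro!: sum.neutral)
  ultimately show "\<exists>H\<subseteq>A \<times> B. finite H \<and>
      (\<forall>c\<in>A \<times> B - H. \<forall>k\<le>n. (case c of (a, b) \<Rightarrow> f a * g b) $ k = 0) \<and>
      (\<forall>k\<le>n. (\<Sum>(a, b)\<in>H. f a * g b) $ k = (S * T) $ k)"
    using F(1,2) G(1,2) by (intro exI[of _ "F \<times> G"]) auto
qed

lemma fps_sums_cmult:
  assumes "fps_sums f A S"
  shows "fps_sums (\<lambda>a. c * f a) A (c * S)"
  unfolding fps_sums_def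
proof
  fix n
  obtain F where F: "F \<subseteq> A" "finite F" "\<And>a k. a \<in> A \<Longrightarrow> a \<notin> F \<Longrightarrow> k \<le> n \<Longrightarrow> f a $ k = 0"
    "\<And>k. k \<le> n \<Longrightarrow> sum f F $ k = S $ k"
    using assms by (rule fps_sumsE[where n = n]) (rule that)
  have "(\<Sum>a\<in>F. c * f a) $ k = (c * S) $ k" if "k \<le> n" for k
    using that F(4) by (simp add: fps_mult_nth flip: sum_distrib_left)
  then show "\<exists>F\<subseteq>A. finite F \<and> (\<forall>a\<in>A - F. \<forall>k\<le>n. (c * f a) $ k = 0) \<and>
      (\<forall>k\<le>n. (\<Sum>a\<in>F. c * f a) $ k = (c * S) $ k)"
    using F by (intro exI[of _ F]) (auto simp: fps_mult_nth)
qed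

lemma fps_sums_singleton: "fps_sums f {a} (f a)"
  by (auto simp: fps_sums_def intro!: exI[of _ "{a}"])

lemma fps_sums_nth_single:
  assumes "fps_sums f A S" "a0 \<in> A" "\<And>a. a \<in> A \<Longrightarrow> a \<noteq> a0 \<Longrightarrow> f a $ n = 0"
  shows "S $ n = f a0 $ n"
proof -
  obtain F where F: "F \<subseteq> A" "finite F" "\<And>a k. a \<in> A \<Longrightarrow> a \<notin> F \<Longrightarrow> k \<le> n \<Longrightarrow> f a $ k = 0"
    "\<And>k. k \<le> n \<Longrightarrow> sum f F $ k = S $ k"
    using assms(1) by (rule fps_sumsE[where n = n]) (rule that)
  have "(\<Sum>a\<in>F. f a $ n) = (\<Sum>a\<in>{a0}. f a $ n)"
    using F assms(2,3) by (intro sum.mono_neutral_cong) auto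
  then show ?thesis
    using F(4)[of n] by (simp add: fps_sum_nth)
qed

section \<open>Order estimates and the geometric series\<close>

lemma fps_X_power_dvd_imp_nth_eq_0:
  fixes f :: "'a::comm_ring_1 fps"
  assumes "fps_X ^ n dvd f" "k < n"
  shows "f $ k = 0"
  using assms by (auto simp: dvd_def fps_X_power_mult_nth)

lemma fps_X_dvd_if_nth_0_eq_0:
  fixes f :: "'a::comm_ring_1 fps"
  assumes "f $ 0 = 0"
  shows "fps_X dvd f"
proof
  show "f = fps_X * fps_shift 1 f"
    using assms by (auto intro!: fps_ext simp: fps_X_mult_nth)
qed

lemma fps_X_power_dvd_power:
  fixes f :: "'a::comm_ring_1 fps"
  assumes "f $ 0 = 0" "m \<le> n"
  shows "fps_X ^ m dvd f ^ n"
  by (meson assms dvd_power_le fps_X_dvd_if_nth_0_eq_0)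

lemma fps_sums_nat:
  fixes f :: "nat \<Rightarrow> 'a::comm_ring_1 fps"
  assumes "\<And>n. n \<in> A \<Longrightarrow> fps_X ^ n dvd f n"
  shows "fps_sums f A (infsum f A)"
proof (rule fps_sums_infsum)
  fix n
  have "{a \<in> A. f a $ n \<noteq> 0} \<subseteq> {..n}"
    using fps_X_power_dvd_imp_nth_eq_0[OF assms] by (auto simp flip: not_less)
  then show "finite {a \<in> A. f a $ n \<noteq> 0}"
    using finite_subset by blast
qed

lemma fps_geometric:
  fixes y :: "'a::comm_ring_1 fps"
  assumes "y $ 0 = 0"
  shows "\<exists>g. fps_sums (\<lambda>k. y ^ k) UNIV g \<and> (1 - y) * g = 1"
proof (intro exI conjI)
  let ?g = "infsum (\<lambda>k. y ^ k) UNIV"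
  show g: "fps_sums (\<lambda>k. y ^ k) UNIV ?g"
    using assms by (intro fps_sums_nat fps_X_power_dvd_power) auto
  \<comment> \<open>Splitting off exponent 0 and shifting the others yields the equation
    \<open>?g = 1 + y * ?g\<close>.\<close>
  have "fps_sums (\<lambda>k. y ^ k) (insert 0 (range Suc)) (1 + y * ?g)"
    using fps_sums_Un_disjoint[OF fps_sums_singleton[of "\<lambda>k. y ^ k" 0], of "range Suc" "y * ?g"]
      fps_sums_reindex[of Suc UNIV "\<lambda>k. y ^ k"] fps_sums_cmult[OF g, of y]
    by auto
  then have "?g = 1 + y * ?g"
    using fps_sums_imp_infsum UNIV_nat_eq by metis
  then show "(1 - y) * ?g = 1"
    by (simp add: algebra_simps)
qed

section \<open>Limits, quotients and q-Pochhammer symbols\<close>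

lemma tendsto_fps_add:
  fixes f g :: "'b \<Rightarrow> 'a::comm_ring_1 fps"
  assumes "(f \<longlongrightarrow> S) F" "(g \<longlongrightarrow> T) F"
  shows "((\<lambda>n. f n + g n) \<longlongrightarrow> S + T) F"
  unfolding tendsto_fps_iff
proof
  fix n
  have "\<forall>\<^sub>F x in F. f x $ n = S $ n" "\<forall>\<^sub>F x in F. g x $ n = T $ n"
    using assms unfolding tendsto_fps_iff by blast+
  then show "\<forall>\<^sub>F x in F. (f x + g x) $ n = (S + T) $ n"
    by eventually_elim simp
qed

lemma tendsto_fps_mult:
  fixes f g :: "'b \<Rightarrow> 'a::comm_ring_1 fps"
  assumes "(f \<longlongrightarrow> S) F" "(g \<longlongrightarrow> T) F"
  shows "((\<lambda>n. f n * g n) \<longlongrightarrow> S * T) F"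
  unfolding tendsto_fps_iff
proof
  fix n
  have "\<forall>\<^sub>F x in F. \<forall>k\<in>{..n}. f x $ k = S $ k \<and> g x $ k = T $ k"
    using assms unfolding tendsto_fps_iff
    by (intro eventually_ball_finite) (auto intro: eventually_conj)
  then show "\<forall>\<^sub>F x in F. (f x * g x) $ n = (S * T) $ n"
    by eventually_elim (simp add: fps_mult_nth)
qed

lemma fps_quot_eqI:
  fixes f g h :: "'a::comm_ring_1 fps"
  assumes "g $ 0 = 1" "h * g = f"
  shows "h = f \<oslash> g"
proof -
  have "g * fps_right_inverse g 1 = 1"
    using assms(1) by (intro fps_right_inverse) simp
  then show ?thesis
    using assms(2) by (auto simp: fps_quot_def mult.assoc)
qed

lemma qpoch_Suc: "qpoch a q (Suc n) = qpoch a q n * (1 - a * q ^ n)"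
  by (simp add: qpoch_def)

lemma qpoch_0: "qpoch a q 0 = 1"
  by (simp add: qpoch_def)

lemma qpoch_nth_0:
  fixes a q :: "'a::comm_ring_1 fps"
  assumes "a $ 0 = 0"
  shows "qpoch a q n $ 0 = 1"
  by (induction n) (simp_all add: qpoch_0 qpoch_Suc assms)

lemma qpoch_inf_nth_0:
  fixes a q :: "'a::comm_ring_1 fps"
  assumes "a $ 0 = 0" "q $ 0 = 0"
  shows "qpoch_inf a q $ 0 = 1"
proof -
  have "\<forall>\<^sub>F n in sequentially. qpoch a q n $ 0 = qpoch_inf a q $ 0"
    using qpoch_LIMSEQ[OF assms] unfolding tendsto_fps_iff by blast
  then show ?thesis
    by (simp add: qpoch_nth_0 assms eventually_const)
qed

section \<open>Telescoping of the two series\<close>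

text \<open>Terms are added in the order \<open>B N\<close>, \<open>A (Suc N)\<close>. The first
  addition rests on \<open>(1 - x^2 * p^(2*N)) + (x^2 * p^(2*N) + u * p^(4*N)) = 1 + u *
  p^(4*N)\<close>, the second on \<open>(1 - p^(2*N+2)) + (p^(2*N+2) + v * p^(4*N)) = 1 + v *
  p^(4*N)\<close>; each appends one factor to the numerator product and one to the
  denominator.\<close>

lemma telescoping_partial_sum:
  fixes x p u v :: "'a::comm_ring_1 fps"
  assumes "x $ 0 = 0" "p $ 0 = 0"
  defines "A \<equiv> \<lambda>n. ((p^(2*n) + v * p^(4*(n-1))) * qpoch (-u) (p^4) n * qpoch (-v) (p^4) (n-1))
              \<oslash> (qpoch (p^2) (p^2) n * qpoch (x^2) (p^2) n)"
    and "B \<equiv> \<lambda>n. ((x^2 * p^(2*n) + u * p^(4*n)) * qpoch (-u) (p^4) n * qpoch (-v) (p^4) n)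
              \<oslash> (qpoch (p^2) (p^2) n * qpoch (x^2) (p^2) (n+1))"
  shows "(1 + (\<Sum>n<N. A (Suc n)) + (\<Sum>n<N. B n)) * (qpoch (p^2) (p^2) N * qpoch (x^2) (p^2) N)
           = qpoch (-u) (p^4) N * qpoch (-v) (p^4) N"
proof (induction N)
  case 0
  then show ?case by (simp add: qpoch_0)
next
  case (Suc N)
  let ?D = "qpoch (p^2) (p^2)" and ?E = "qpoch (x^2) (p^2)"
    and ?U = "qpoch (-u) (p^4)" and ?V = "qpoch (-v) (p^4)"
  let ?T = "1 + (\<Sum>n<N. A (Suc n)) + (\<Sum>n<N. B n)"
  have unit: "(?D m * ?E n) $ 0 = 1" for m n
    using assms(1,2) by (simp add: qpoch_nth_0 fps_power_zeroth)
  have A: "A (Suc N) * (?D (Suc N) * ?E (Suc N)) = (p^(2*N+2) + v * p^(4*N)) * ?U (Suc N) * ?V N"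
    unfolding A_def by (subst fps_quot_mult[OF unit]) simp
  have B: "B N * (?D N * ?E (Suc N)) = (x^2 * p^(2*N) + u * p^(4*N)) * ?U N * ?V N"
    unfolding B_def using fps_quot_mult[OF unit] by simp
  have "(?T + B N) * (?D N * ?E (Suc N))
      = (?T * (?D N * ?E N)) * (1 - x^2 * p^(2*N)) + B N * (?D N * ?E (Suc N))"
    by (simp add: qpoch_Suc algebra_simps flip: power_mult)
  also have "\<dots> = ?U (Suc N) * ?V N"
    unfolding B Suc.IH by (simp add: qpoch_Suc algebra_simps flip: power_mult)
  finally have TB: "(?T + B N) * (?D N * ?E (Suc N)) = ?U (Suc N) * ?V N" .
  have D: "?D (Suc N) = ?D N * (1 - p^(2*N+2))"
    by (simp only: qpoch_Suc power_add power_mult) (simp only: mult.commute)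
  have "(?T + B N + A (Suc N)) * (?D (Suc N) * ?E (Suc N))
      = ((?T + B N) * (?D N * ?E (Suc N))) * (1 - p^(2*N+2)) + A (Suc N) * (?D (Suc N) * ?E (Suc N))"
    unfolding D by (simp only: distrib_right) (simp only: mult_ac)
  also have "\<dots> = ?U (Suc N) * ?V (Suc N)"
    unfolding A TB by (simp add: qpoch_Suc[of "-v"] algebra_simps flip: power_mult)
  finally show ?case
    by (simp add: add_ac)
qed

lemma telescoping_series:
  fixes x p u v :: "'a::comm_ring_1 fps"
  assumes "x $ 0 = 0" "p $ 0 = 0" "u $ 0 = 0" "v $ 0 = 0"
  defines "A \<equiv> \<lambda>n. ((p^(2*n) + v * p^(4*(n-1))) * qpoch (-u) (p^4) n * qpoch (-v) (p^4) (n-1))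
              \<oslash> (qpoch (p^2) (p^2) n * qpoch (x^2) (p^2) n)"
    and "B \<equiv> \<lambda>n. ((x^2 * p^(2*n) + u * p^(4*n)) * qpoch (-u) (p^4) n * qpoch (-v) (p^4) n)
              \<oslash> (qpoch (p^2) (p^2) n * qpoch (x^2) (p^2) (n+1))"
  shows "A summable_on {1..}" and "B summable_on UNIV"
    and "1 + (\<Sum>\<^sub>\<infinity>n\<in>{1..}. A n) + (\<Sum>\<^sub>\<infinity>n. B n) =
           (qpoch_inf (-u) (p^4) * qpoch_inf (-v) (p^4)) \<oslash> (qpoch_inf (x^2) (p^2) * qpoch_inf (p^2) (p^2))"
proof -
  have nth_0: "p^2 $ 0 = 0" "p^4 $ 0 = 0" "x^2 $ 0 = 0"
    using assms(1,2) by (simp_all add: fps_power_zeroth)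
  have powdvd: "fps_X ^ n dvd p ^ m" if "n \<le> m" for m n
    using fps_X_power_dvd_power[OF assms(2) that] .
  \<comment> \<open>For \<open>n = 1\<close> the power of \<open>p\<close> is trivial; the missing
    factor \<open>fps_X\<close> comes from the zero constant coefficient of
    \<open>v\<close>.\<close>
  have "fps_X ^ n dvd v * p^(4*(n-1))" if "n \<ge> 1" for n
  proof -
    have "fps_X * fps_X ^ (n - 1) dvd v * p^(4*(n-1))"
      using assms(4) by (intro mult_dvd_mono fps_X_dvd_if_nth_0_eq_0 powdvd) auto
    then show ?thesis
      using that by (metis One_nat_def Suc_le_eq power_eq_if not_less_zero)
  qed
  then have "fps_X ^ n dvd A n" if "n \<in> {1..}" for n
    using that powdvd[of n "2*n"] by (auto simp: A_def fps_quot_def intro!: dvd_mult2 dvd_add)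
  note hsA = fps_sums_imp_has_sum[OF fps_sums_nat[of "{1..}" A, OF this]]
  have "fps_X ^ n dvd B n" for n
    using powdvd[of n "2*n"] powdvd[of n "4*n"]
    by (auto simp: B_def fps_quot_def intro!: dvd_mult2 dvd_add intro: dvd_mult)
  note hsB = fps_sums_imp_has_sum[OF fps_sums_nat[OF this, of UNIV]]
  show "A summable_on {1..}" "B summable_on UNIV"
    using hsA hsB has_sum_imp_summable by blast+
  have "range Suc = {1..}"
    by (auto simp: Suc_le_eq gr0_conv_Suc)
  then have "((\<lambda>n. A (Suc n)) has_sum (\<Sum>\<^sub>\<infinity>n\<in>{1..}. A n)) UNIV"
    using hsA has_sum_reindex[of Suc UNIV A] by (simp add: o_def)
  then have "(\<lambda>N. 1 + (\<Sum>n<N. A (Suc n)) + (\<Sum>n<N. B n)) \<longlonglongrightarrow>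
      1 + (\<Sum>\<^sub>\<infinity>n\<in>{1..}. A n) + (\<Sum>\<^sub>\<infinity>n. B n)"
    using has_sum_imp_sums hsB unfolding sums_def by (intro tendsto_fps_add tendsto_const) auto
  then have "(\<lambda>N. (1 + (\<Sum>n<N. A (Suc n)) + (\<Sum>n<N. B n)) * (qpoch (p^2) (p^2) N * qpoch (x^2) (p^2) N))
      \<longlonglongrightarrow> (1 + (\<Sum>\<^sub>\<infinity>n\<in>{1..}. A n) + (\<Sum>\<^sub>\<infinity>n. B n)) * (qpoch_inf (p^2) (p^2) * qpoch_inf (x^2) (p^2))"
    using assms(3,4) by (intro tendsto_fps_mult qpoch_LIMSEQ) (simp_all only: nth_0)
  moreover have "(\<lambda>N. qpoch (-u) (p^4) N * qpoch (-v) (p^4) N) \<longlonglongrightarrow> qpoch_inf (-u) (p^4) * qpoch_inf (-v) (p^4)"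
    using assms(3,4) by (intro tendsto_fps_mult qpoch_LIMSEQ) (simp_all add: nth_0)
  ultimately have "(1 + (\<Sum>\<^sub>\<infinity>n\<in>{1..}. A n) + (\<Sum>\<^sub>\<infinity>n. B n)) * (qpoch_inf (p^2) (p^2) * qpoch_inf (x^2) (p^2))
      = qpoch_inf (-u) (p^4) * qpoch_inf (-v) (p^4)"
    unfolding A_def B_def telescoping_partial_sum[OF assms(1,2)] using LIMSEQ_unique by blast
  then show "1 + (\<Sum>\<^sub>\<infinity>n\<in>{1..}. A n) + (\<Sum>\<^sub>\<infinity>n. B n) =
      (qpoch_inf (-u) (p^4) * qpoch_inf (-v) (p^4)) \<oslash> (qpoch_inf (x^2) (p^2) * qpoch_inf (p^2) (p^2))"
    by (intro fps_quot_eqI) (simp_all add: qpoch_inf_nth_0 nth_0 mult.commute)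
qed

section \<open>Admissible lists and their construction from tails\<close>

definition head0 :: "nat list \<Rightarrow> nat" where
  "head0 l = (case l of [] \<Rightarrow> 0 | x # _ \<Rightarrow> x)"

lemma head0_simps [simp]: "head0 [] = 0" "head0 (x # xs) = x"
  by (simp_all add: head0_def)

text \<open>Differences of consecutive parts are an even surplus plus \<open>a\<close> after an odd part and \<open>b\<close> before
  one; \<open>P1\<close> is the case \<open>(a, b) = (3, 1)\<close> and \<open>P2\<close> the case \<open>(1, 3)\<close>. Treating the end of the list as a
  part \<open>0\<close> excludes the part \<open>1\<close> when \<open>b = 3\<close>.\<close>

fun adm :: "nat \<Rightarrow> nat \<Rightarrow> nat list \<Rightarrow> bool" where
  "adm a b [] \<longleftrightarrow> True"
| "adm a b (x # xs) \<longleftrightarrow> x > 0 \<and> adm a b xs \<and>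
     (\<exists>k. head0 xs + 2 * k + (if odd (head0 xs) then a else 0) + (if odd x then b else 0) = x)"

text \<open>The existential in \<open>adm.simps(2)\<close> makes the simplifier loop.\<close>

declare adm.simps(2) [simp del]

lemma adm_ConsD:
  assumes "adm a b (x # xs)"
  shows "x > 0" "adm a b xs" "head0 xs \<le> x"
proof -
  obtain k where "head0 xs + 2 * k + (if odd (head0 xs) then a else 0) + (if odd x then b else 0) = x"
    using assms unfolding adm.simps(2) by blast
  then show "head0 xs \<le> x"
    by linarith
  show "x > 0" "adm a b xs"
    using assms unfolding adm.simps(2) by blast+
qed

lemma adm_head0_pos:
  assumes "adm a b l"
  shows "head0 l = 0 \<longleftrightarrow> l = []"
proof (cases l)
  case (Cons x xs)
  then have "x > 0"
    using assms adm_ConsD(1) by blast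
  then show ?thesis
    using Cons by simp
qed simp

lemma is_partition_Cons: "is_partition (x # xs) \<longleftrightarrow> x > 0 \<and> is_partition xs \<and> head0 xs \<le> x"
proof -
  have "(\<forall>y\<in>set xs. y \<le> x) \<longleftrightarrow> head0 xs \<le> x" if "sorted_wrt (\<ge>) xs"
    using that by (cases xs) auto
  then show ?thesis
    by (auto simp: is_partition_def)
qed

lemma adm_imp_is_partition: "adm a b l \<Longrightarrow> is_partition l"
proof (induction l)
  case Nil
  then show ?case by (simp add: is_partition_def)
next
  case (Cons x xs)
  show ?case
    unfolding is_partition_Cons using adm_ConsD[OF Cons.prems] Cons.IH by blast
qed

text \<open>Height 0 encodes the empty list. In \<open>extend\<close> an admissible tail yields
  height 0 only if it is empty itself, so no tail is lost.\<close>

definition stack :: "nat \<Rightarrow> nat list \<Rightarrow> nat list" where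
  "stack h l = (if h = 0 then [] else h # l)"

lemma head0_stack [simp]: "head0 (stack h l) = h"
  by (simp add: stack_def)

lemma stack_inject: "h \<noteq> 0 \<Longrightarrow> stack h l = stack h l' \<longleftrightarrow> l = l'"
  by (simp add: stack_def)

text \<open>\<open>k\<close> is half the even surplus, and \<open>d\<close> will be \<open>b\<close>
  or 0 according to the parity wanted for the new head. Every tail admits every \<open>k\<close>, so
  weight sums over the image factor.\<close>

definition extend :: "nat \<Rightarrow> nat \<Rightarrow> nat \<times> nat list \<Rightarrow> nat list" where
  "extend a d = (\<lambda>(k, l). stack (head0 l + 2 * k + (if odd (head0 l) then a else 0) + d) l)"

text \<open>The head of the result gives the height. A positive height leaves the tail visible,
  which then determines \<open>k\<close>; height 0 forces \<open>k = 0\<close> and an empty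
  tail.\<close>

lemma inj_on_extend: "inj_on (extend a d) (UNIV \<times> {l. adm a b l})"
proof (rule inj_onI, clarify)
  fix k l k' l'
  assume l: "adm a b l" "adm a b l'" and eq: "extend a d (k, l) = extend a d (k', l')"
  let ?h = "\<lambda>k l. head0 l + 2 * k + (if odd (head0 l) then a else 0) + d"
  have h: "?h k l = ?h k' l'"
    using arg_cong[OF eq, of head0] by (simp add: extend_def)
  show "k = k' \<and> l = l'"
  proof (cases "?h k l = 0")
    case True
    moreover from this h have "?h k' l' = 0"
      by (rule subst[rotated])
    ultimately have "head0 l = 0" "head0 l' = 0" "k = 0" "k' = 0"
      by linarith+
    then show ?thesis
      using l adm_head0_pos by metis
  next
    case False
    moreover have "stack (?h k l) l = stack (?h k l) l'"
      using eq unfolding extend_def prod.case h .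
    ultimately have "l = l'"
      by (rule iffD1[OF stack_inject])
    moreover from this have "?h k l = ?h k' l"
      using h by (simp only:)
    then have "k = k'"
      by linarith
    ultimately show ?thesis
      by blast
  qed
qed

lemma extend_image:
  assumes "odd a" "odd b"
  shows "extend a (if t then b else 0) ` (UNIV \<times> {l. adm a b l}) = {l. adm a b l \<and> odd (head0 l) = t}"
    (is "?L = ?R")
proof
  show "?L \<subseteq> ?R"
  proof (intro image_subsetI)
    fix kl assume "kl \<in> (UNIV :: nat set) \<times> {l. adm a b l}"
    then obtain k l where kl: "kl = (k, l)" "adm a b l"
      by auto
    define h where "h = head0 l + 2 * k + (if odd (head0 l) then a else 0) + (if t then b else 0)"
    have ext: "extend a (if t then b else 0) kl = stack h l"
      by (simp add: extend_def kl(1) h_def)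
    \<comment> \<open>As \<open>a\<close> is odd, \<open>head0 l\<close> together with its
      correction is even, so the last summand alone decides the parity.\<close>
    have h: "odd h = t"
      using assms by (simp add: h_def)
    have "\<exists>k. head0 l + 2 * k + (if odd (head0 l) then a else 0) + (if odd h then b else 0) = h"
      unfolding h by (intro exI[of _ k]) (simp add: h_def)
    then have "adm a b (stack h l)"
      unfolding stack_def using kl(2) by (simp add: adm.simps(2))
    then show "extend a (if t then b else 0) kl \<in> ?R"
      using h by (simp add: ext)
  qed
  show "?R \<subseteq> ?L"
  proof
    fix l assume "l \<in> ?R"
    then have l: "adm a b l" "odd (head0 l) = t"
      by auto
    show "l \<in> ?L"
    proof (cases l)
      case Nil
      \<comment> \<open>The empty list has the even head 0, so \<open>t\<close> is false here and
        the last summand is 0.\<close>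
      then have "l = extend a (if t then b else 0) (0, [])"
        using l by (simp add: extend_def stack_def)
      then show ?thesis
        by (intro image_eqI[of _ _ "(0, [])"]) auto
    next
      case (Cons x xs)
      then have xs: "adm a b xs"
        using l adm_ConsD Cons by blast
      obtain k where
        "head0 xs + 2 * k + (if odd (head0 xs) then a else 0) + (if odd x then b else 0) = x"
        using l(1) unfolding Cons adm.simps(2) by blast
      moreover have "odd x = t" "x > 0"
        using l Cons adm_ConsD(1) by simp_all
      ultimately have "l = extend a (if t then b else 0) (k, xs)"
        unfolding Cons by (simp add: extend_def stack_def[of x])
      then show ?thesis
        using xs by (intro image_eqI[of _ _ "(k, xs)"]) auto
    qed
  qed
qed

section \<open>Weights by columns of the Young diagram\<close>

text \<open>\<open>col_wt x p i\<close> belongs to a column of height \<open>i + 1\<close> of the Young diagram, and \<open>wt x p i l\<close> is the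
  weight of \<open>l\<close> placed below \<open>i\<close> rows.\<close>

definition col_wt :: "'a::comm_ring_1 fps \<Rightarrow> 'a fps \<Rightarrow> nat \<Rightarrow> 'a fps" where
  "col_wt x p i = (if even i then x * p ^ (i div 2) else p ^ (i div 2 + 1))"

fun wt :: "'a::comm_ring_1 fps \<Rightarrow> 'a fps \<Rightarrow> nat \<Rightarrow> nat list \<Rightarrow> 'a fps" where
  "wt x p i [] = 1"
| "wt x p i (m # l) = col_wt x p i ^ (m - head0 l) * wt x p (Suc i) l"

lemma col_wt_dvd:
  fixes x p :: "'a::comm_ring_1 fps"
  assumes "x $ 0 = 0" "p $ 0 = 0"
  shows "fps_X ^ (i div 2 + 1) dvd col_wt x p i"
proof (cases "even i")
  case True
  then show ?thesis
    using assms
    by (auto simp: col_wt_def intro!: mult_dvd_mono fps_X_dvd_if_nth_0_eq_0 fps_X_power_dvd_power)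
next
  case False
  then show ?thesis
    unfolding col_wt_def using fps_X_power_dvd_power[OF assms(2) order_refl] by (simp only: if_False)
qed

lemma col_wt_nth_0:
  fixes x p :: "'a::comm_ring_1 fps"
  assumes "x $ 0 = 0" "p $ 0 = 0"
  shows "col_wt x p i $ 0 = 0"
  using assms by (simp add: col_wt_def)

text \<open>The columns of \<open>l\<close> also pass through the \<open>i\<close> rows above it, so
  they contain \<open>i * head0 l + sum_list l\<close> cells in all. A column of height
  \<open>j\<close> has order at least \<open>j / 2\<close>, which gives half the number of
  cells.\<close>

lemma wt_dvd:
  fixes x p :: "'a::comm_ring_1 fps"
  assumes "x $ 0 = 0" "p $ 0 = 0" "adm a b l"
  shows "\<exists>d. fps_X ^ d dvd wt x p i l \<and> i * head0 l + sum_list l \<le> 2 * d"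
  using assms(3)
proof (induction l arbitrary: i)
  case Nil
  then show ?case by (auto intro!: exI[of _ 0])
next
  case (Cons m l)
  then have "adm a b l"
    using adm_ConsD(2) by blast
  then obtain d where d: "fps_X ^ d dvd wt x p (Suc i) l" "Suc i * head0 l + sum_list l \<le> 2 * d"
    using Cons.IH by blast
  define r where "r = m - head0 l"
  have m: "m = head0 l + r"
    using adm_ConsD(3)[OF Cons.prems] by (simp add: r_def)
  have "fps_X ^ ((i div 2 + 1) * r) dvd col_wt x p i ^ r"
    unfolding power_mult by (intro dvd_power_same col_wt_dvd assms)
  then have "fps_X ^ ((i div 2 + 1) * r + d) dvd wt x p i (m # l)"
    using d(1) unfolding power_add wt.simps r_def by (rule mult_dvd_mono)
  moreover have "Suc i \<le> 2 * (i div 2 + 1)"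
    by simp
  then have "Suc i * r \<le> 2 * ((i div 2 + 1) * r)"
    unfolding mult.assoc[symmetric] by (rule mult_le_mono1)
  then have "i * m + (m + sum_list l) \<le> 2 * ((i div 2 + 1) * r + d)"
    using d(2) by (simp add: m algebra_simps)
  ultimately show ?case
    by (intro exI[of _ "(i div 2 + 1) * r + d"]) auto
qed

lemma wt_nth_eq_0:
  fixes x p :: "'a::comm_ring_1 fps"
  assumes "x $ 0 = 0" "p $ 0 = 0" "adm a b l" "2 * n < i * head0 l + sum_list l"
  shows "wt x p i l $ n = 0"
proof -
  obtain d where "fps_X ^ d dvd wt x p i l" "i * head0 l + sum_list l \<le> 2 * d"
    using wt_dvd[OF assms(1-3)] by blast
  then show ?thesis
    using assms(4) by (intro fps_X_power_dvd_imp_nth_eq_0) auto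
qed

lemma finite_partitions_le: "finite {l. is_partition l \<and> sum_list l \<le> n}"
proof (rule finite_subset)
  have "length l \<le> sum_list l" if "\<forall>x\<in>set l. x > 0" for l :: "nat list"
    using that by (induction l) auto
  then show "{l. is_partition l \<and> sum_list l \<le> n} \<subseteq> {l. set l \<subseteq> {..n} \<and> length l \<le> n}"
    unfolding is_partition_def by (blast intro: le_trans member_le_sum_list)
  show "finite {l. set l \<subseteq> {..n} \<and> length l \<le> n}"
    by (intro finite_lists_length_le) auto
qed

text \<open>By the order estimate, coefficient \<open>n\<close> sees only partitions of size at most
  \<open>2 * n\<close>. \<open>Q\<close> serves to select the parity of the head.\<close>

lemma fps_sums_wt:
  fixes x p :: "'a::comm_ring_1 fps"
  assumes "x $ 0 = 0" "p $ 0 = 0"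
  shows "fps_sums (wt x p i) {l. adm a b l \<and> Q l} (infsum (wt x p i) {l. adm a b l \<and> Q l})"
proof (rule fps_sums_infsum)
  fix n
  have "{l \<in> {l. adm a b l \<and> Q l}. wt x p i l $ n \<noteq> 0} \<subseteq> {l. is_partition l \<and> sum_list l \<le> 2 * n}"
  proof clarify
    fix l assume l: "adm a b l" "wt x p i l $ n \<noteq> 0"
    then have "\<not> 2 * n < i * head0 l + sum_list l"
      using wt_nth_eq_0[OF assms] by blast
    then show "is_partition l \<and> sum_list l \<le> 2 * n"
      using adm_imp_is_partition[OF l(1)] by linarith
  qed
  then show "finite {l \<in> {l. adm a b l \<and> Q l}. wt x p i l $ n \<noteq> 0}"
    using finite_subset finite_partitions_le by blast
qed

section \<open>Recursion for the generating functions of tails\<close>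

text \<open>Splitting off the first part: the even surplus \<open>2 * k\<close> gives the geometric series, and the
  remaining factor depends on the next part only through its parity.\<close>

lemma infsum_wt_parity:
  fixes x p :: "'a::comm_ring_1 fps" and a b :: nat
  assumes "x $ 0 = 0" "p $ 0 = 0" "odd a" "odd b"
  defines "c \<equiv> col_wt x p" and "E \<equiv> \<lambda>i t. infsum (wt x p i) {l. adm a b l \<and> odd (head0 l) = t}"
  shows "(1 - c i ^ 2) * E i t = c i ^ (if t then b else 0) * (E (Suc i) False + c i ^ a * E (Suc i) True)"
proof -
  let ?d = "if t then b else 0" and ?e = "\<lambda>l. if odd (head0 l) then a else 0"
  let ?A = "{l. adm a b l}"
  have "(c i ^ 2) $ 0 = 0"
    using col_wt_nth_0[OF assms(1,2)] by (simp add: c_def power2_eq_square)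
  \<comment> \<open>Each unit of \<open>k\<close> adds two columns of height \<open>i + 1\<close>;
    \<open>g\<close> collects them and inverts \<open>1 - c i ^ 2\<close>.\<close>
  then obtain g where g: "fps_sums (\<lambda>k. (c i ^ 2) ^ k) UNIV g" "(1 - c i ^ 2) * g = 1"
    using fps_geometric by blast
  define S where "S = E (Suc i) False + c i ^ a * E (Suc i) True"
  have sums: "fps_sums (wt x p i) {l. adm a b l \<and> odd (head0 l) = t} (E i t)" for i t
    unfolding E_def by (rule fps_sums_wt[OF assms(1,2)])
  \<comment> \<open>On each parity class of tails, \<open>?w\<close> is a constant multiple of the
    tail weight.\<close>
  let ?w = "\<lambda>l. c i ^ ?e l * wt x p (Suc i) l"
    and ?Ev = "{l. adm a b l \<and> odd (head0 l) = False}" and ?Od = "{l. adm a b l \<and> odd (head0 l) = True}"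
  have "fps_sums ?w ?Ev (E (Suc i) False)"
    using sums[of "Suc i" False] by (subst fps_sums_cong[where g = "wt x p (Suc i)"]) auto
  moreover have "fps_sums ?w ?Od (c i ^ a * E (Suc i) True)"
    using fps_sums_cmult[OF sums[of "Suc i" True]]
    by (subst fps_sums_cong[where g = "\<lambda>l. c i ^ a * wt x p (Suc i) l"]) auto
  ultimately have "fps_sums ?w (?Ev \<union> ?Od) S"
    unfolding S_def by (rule fps_sums_Un_disjoint) auto
  moreover have "?Ev \<union> ?Od = ?A"
    by blast
  ultimately have "fps_sums ?w ?A S"
    by (simp only:)
  then have sumprod: "fps_sums (\<lambda>(k, l). (c i ^ 2) ^ k * (c i ^ ?d * ?w l)) (UNIV \<times> ?A)
      (g * (c i ^ ?d * S))"
    by (intro fps_sums_mult fps_sums_cmult g(1))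
  \<comment> \<open>At height 0 all exponents vanish and the tail is empty, so both sides are 1.
    Otherwise \<open>2 * k + ?e l + ?d\<close> columns end in the new row.\<close>
  have wt_extend: "wt x p i (extend a ?d (k, l)) = (c i ^ 2) ^ k * (c i ^ ?d * ?w l)" if "adm a b l" for k l
  proof (cases "head0 l + 2 * k + ?e l + ?d = 0")
    case True
    then show ?thesis
      using adm_head0_pos[OF that] by (simp add: extend_def stack_def)
  next
    case False
    then have "extend a ?d (k, l) = (head0 l + (2 * k + ?e l + ?d)) # l"
      by (simp add: extend_def stack_def)
    then have "wt x p i (extend a ?d (k, l)) = c i ^ (2 * k + ?e l + ?d) * wt x p (Suc i) l"
      unfolding c_def by (simp only: wt.simps diff_add_inverse)
    then show ?thesis
      unfolding power_add power_mult by (simp only: mult_ac)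
  qed
  have "fps_sums (\<lambda>kl. wt x p i (extend a ?d kl)) (UNIV \<times> ?A) (g * (c i ^ ?d * S))"
  proof (rule iffD2[OF fps_sums_cong sumprod], clarify)
    fix k l assume "adm a b l"
    then show "wt x p i (extend a ?d (k, l)) = (c i ^ 2) ^ k * (c i ^ ?d * ?w l)"
      by (rule wt_extend)
  qed
  then have "fps_sums (wt x p i) (extend a ?d ` (UNIV \<times> ?A)) (g * (c i ^ ?d * S))"
    by (rule fps_sums_reindex[OF inj_on_extend])
  then have "E i t = g * (c i ^ ?d * S)"
    unfolding extend_image[OF assms(3,4)] E_def by (rule fps_sums_imp_infsum)
  then have "(1 - c i ^ 2) * E i t = ((1 - c i ^ 2) * g) * (c i ^ ?d * S)"
    by (simp only: mult.assoc)
  then show ?thesis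
    unfolding g(2) S_def by simp
qed

lemma fps_mult_cancel_left:
  fixes f g h :: "'a::comm_ring_1 fps"
  assumes "f $ 0 = 1" "f * g = f * h"
  shows "g = h"
  using assms fps_quot_eqI[of f] by (metis mult.commute)

text \<open>In the recursion the two parities differ only in the power of
  \<open>col_wt x p i\<close> in front, and the common factor \<open>1 - col_wt x p i ^ 2\<close>
  cancels.\<close>

lemma infsum_wt_odd:
  fixes x p :: "'a::comm_ring_1 fps" and a b :: nat
  assumes "x $ 0 = 0" "p $ 0 = 0" "odd a" "odd b"
  defines "E \<equiv> \<lambda>i t. infsum (wt x p i) {l. adm a b l \<and> odd (head0 l) = t}"
  shows "E i True = col_wt x p i ^ b * E i False"
proof (rule fps_mult_cancel_left)
  show "(1 - col_wt x p i ^ 2) $ 0 = 1"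
    using col_wt_nth_0[OF assms(1,2)] by (simp add: power2_eq_square)
  show "(1 - col_wt x p i ^ 2) * E i True = (1 - col_wt x p i ^ 2) * (col_wt x p i ^ b * E i False)"
    using infsum_wt_parity[OF assms(1-4), of i True] infsum_wt_parity[OF assms(1-4), of i False]
    unfolding E_def by (simp add: mult.left_commute)
qed

text \<open>Eliminating odd heads by \<open>infsum_wt_odd\<close> leaves a first-order recursion for
  even ones, iterated here without quotients.\<close>

lemma prod_times_infsum_wt:
  fixes x p :: "'a::comm_ring_1 fps" and a b :: nat
  assumes "x $ 0 = 0" "p $ 0 = 0" "odd a" "odd b"
  defines "c \<equiv> col_wt x p" and "E \<equiv> \<lambda>i. infsum (wt x p i) {l. adm a b l \<and> odd (head0 l) = False}"
  shows "(\<Prod>i<N. 1 - c i ^ 2) * E 0 = (\<Prod>i<N. 1 + c i ^ a * c (Suc i) ^ b) * E N"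
proof (induction N)
  case 0
  then show ?case by simp
next
  case (Suc N)
  have "(1 - c N ^ 2) * E N = (1 + c N ^ a * c (Suc N) ^ b) * E (Suc N)"
    using infsum_wt_parity[OF assms(1-4), of N False] infsum_wt_odd[OF assms(1-4), of "Suc N"]
    unfolding c_def E_def by (simp add: algebra_simps)
  then have "(\<Prod>i<N. 1 + c i ^ a * c (Suc i) ^ b) * ((1 - c N ^ 2) * E N) =
      (\<Prod>i<Suc N. 1 + c i ^ a * c (Suc i) ^ b) * E (Suc N)"
    by (simp add: mult.assoc)
  moreover have "(\<Prod>i<Suc N. 1 - c i ^ 2) * E 0 = (1 - c N ^ 2) * ((\<Prod>i<N. 1 - c i ^ 2) * E 0)"
    by (simp only: prod.lessThan_Suc mult_ac)
  ultimately show ?case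
    unfolding Suc.IH by (simp only: mult_ac)
qed

text \<open>Below \<open>i\<close> rows a nonempty tail has a column of more than \<open>i\<close>
  cells, so its order grows with \<open>i\<close> and only the empty list survives.\<close>

lemma infsum_wt_tendsto_1:
  fixes x p :: "'a::comm_ring_1 fps" and a b :: nat
  assumes "x $ 0 = 0" "p $ 0 = 0"
  shows "(\<lambda>i. infsum (wt x p i) {l. adm a b l \<and> odd (head0 l) = False}) \<longlonglongrightarrow> 1"
proof (rule tendsto_fpsI)
  fix n
  have "infsum (wt x p i) {l. adm a b l \<and> odd (head0 l) = False} $ n = 1 $ n" if "i \<ge> 2 * n" for i
  proof -
    have "wt x p i l $ n = 0" if l: "adm a b l" "l \<noteq> []" for l
    proof -
      obtain m l' where "l = m # l'"
        using l(2) by (cases l) auto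
      then have "head0 l \<ge> 1" "sum_list l \<ge> 1"
        using l(1) adm_ConsD(1)[of a b m l'] by auto
      then have "i * 1 + 1 \<le> i * head0 l + sum_list l"
        by (intro add_mono mult_le_mono2)
      then show ?thesis
        using \<open>i \<ge> 2 * n\<close> by (intro wt_nth_eq_0[OF assms l(1)]) linarith
    qed
    then have "infsum (wt x p i) {l. adm a b l \<and> odd (head0 l) = False} $ n = wt x p i [] $ n"
      by (intro fps_sums_nth_single[OF fps_sums_wt[OF assms]]) auto
    then show ?thesis by simp
  qed
  then show "\<forall>\<^sub>F i in sequentially.
      infsum (wt x p i) {l. adm a b l \<and> odd (head0 l) = False} $ n = 1 $ n"
    using eventually_sequentially by blast
qed

section \<open>Product formula for admissible lists\<close>

lemma prod_col_wt_denominator: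
  "(\<Prod>i<2 * N. 1 - col_wt x p i ^ 2) = qpoch (x^2) (p^2) N * qpoch (p^2) (p^2) N"
proof (induction N)
  case (Suc N)
  have "1 - col_wt x p (2 * N) ^ 2 = 1 - x^2 * (p^2) ^ N"
    by (simp add: col_wt_def power_mult_distrib mult.commute flip: power_mult)
  moreover have "1 - col_wt x p (Suc (2 * N)) ^ 2 = 1 - p^2 * (p^2) ^ N"
    by (simp add: col_wt_def power_mult_distrib mult.commute flip: power_mult)
  ultimately show ?case
    using Suc by (simp add: qpoch_Suc mult_ac)
qed (simp add: qpoch_0)

text \<open>The factor at \<open>i = 2 * N\<close> is \<open>1 + x^a * p^(4*N + b)\<close>, the one
  at \<open>i = 2 * N + 1\<close> is \<open>1 + x^b * p^(4*(N+1))\<close>, where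
  \<open>a + b = 4\<close> fixes the step. The second family lacks its initial member
  \<open>1 + x^b\<close>, which is therefore put in front.\<close>

lemma prod_col_wt_numerator:
  assumes "a + b = 4"
  shows "(1 + x ^ b) * (\<Prod>i<2 * N. 1 + col_wt x p i ^ a * col_wt x p (Suc i) ^ b)
    = qpoch (-(x^b)) (p^4) (Suc N) * qpoch (-(x^a * p^b)) (p^4) N"
proof (induction N)
  case (Suc N)
  have "col_wt x p (2 * N) ^ a * col_wt x p (Suc (2 * N)) ^ b = x^a * p^(N * (a + b) + b)"
    by (simp add: col_wt_def power_mult_distrib power_add algebra_simps flip: power_mult)
  then have 1: "1 + col_wt x p (2 * N) ^ a * col_wt x p (Suc (2 * N)) ^ b = 1 + x^a * p^b * (p^4) ^ N"
    unfolding assms by (simp add: power_add mult_ac flip: power_mult)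
  have "col_wt x p (Suc (2 * N)) ^ a * col_wt x p (Suc (Suc (2 * N))) ^ b = x^b * p^(Suc N * (a + b))"
    by (simp add: col_wt_def power_mult_distrib power_add algebra_simps flip: power_mult)
  then have 2: "1 + col_wt x p (Suc (2 * N)) ^ a * col_wt x p (Suc (Suc (2 * N))) ^ b = 1 + x^b * (p^4) ^ Suc N"
    unfolding assms by (simp only: power_mult[symmetric] mult.commute)
  let ?P = "\<Prod>i<2 * N. 1 + col_wt x p i ^ a * col_wt x p (Suc i) ^ b"
  let ?r = "1 + x^a * p^b * (p^4) ^ N" and ?s = "1 + x^b * (p^4) ^ Suc N"
  have "(\<Prod>i<2 * Suc N. 1 + col_wt x p i ^ a * col_wt x p (Suc i) ^ b) = ?P * ?r * ?s"
    unfolding mult_Suc_right add_2_eq_Suc prod.lessThan_Suc 1 2 ..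
  then have "(1 + x ^ b) * (\<Prod>i<2 * Suc N. 1 + col_wt x p i ^ a * col_wt x p (Suc i) ^ b) =
      ((1 + x ^ b) * ?P) * (?r * ?s)"
    by (simp only: mult.assoc)
  also have "\<dots> = (qpoch (-(x^b)) (p^4) (Suc N) * ?s) * (qpoch (-(x^a * p^b)) (p^4) N * ?r)"
    unfolding Suc by (simp only: mult_ac)
  also have "\<dots> = qpoch (-(x^b)) (p^4) (Suc (Suc N)) * qpoch (-(x^a * p^b)) (p^4) (Suc N)"
    by (simp only: qpoch_Suc mult_minus_left diff_minus_eq_add)
  finally show ?case .
qed (simp add: qpoch_0 qpoch_Suc)

lemma fps_sums_adm:
  fixes x p :: "'a::comm_ring_1 fps" and a b :: nat
  assumes "x $ 0 = 0" "p $ 0 = 0" "odd a" "odd b" "a + b = 4"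
  shows "fps_sums (wt x p 0) {l. adm a b l}
    ((qpoch_inf (-(x^b)) (p^4) * qpoch_inf (-(x^a * p^b)) (p^4)) \<oslash> (qpoch_inf (x^2) (p^2) * qpoch_inf (p^2) (p^2)))"
proof -
  define E where "E i t = infsum (wt x p i) {l. adm a b l \<and> odd (head0 l) = t}" for i t
  let ?D = "\<lambda>N. qpoch (x^2) (p^2) N * qpoch (p^2) (p^2) N"
  let ?U = "qpoch (-(x^b)) (p^4)" and ?V = "qpoch (-(x^a * p^b)) (p^4)"
  have nth_0: "p^2 $ 0 = 0" "p^4 $ 0 = 0" "x^2 $ 0 = 0" "(-(x^b)) $ 0 = 0" "(-(x^a * p^b)) $ 0 = 0"
    using assms by (simp_all add: fps_power_zeroth zero_power odd_pos)
  have "fps_sums (wt x p 0) ({l. adm a b l \<and> odd (head0 l) = False} \<union> {l. adm a b l \<and> odd (head0 l) = True})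
      (E 0 False + E 0 True)"
    unfolding E_def by (intro fps_sums_Un_disjoint fps_sums_wt assms(1,2)) auto
  moreover have "{l. adm a b l} = {l. adm a b l \<and> odd (head0 l) = False} \<union> {l. adm a b l \<and> odd (head0 l) = True}"
    by blast
  \<comment> \<open>Since \<open>col_wt x p 0 = x\<close>, odd heads contribute \<open>x ^ b\<close>
    times the even ones; this supplies the extra factor \<open>1 + x ^ b\<close>.\<close>
  moreover have "E 0 True = x ^ b * E 0 False"
    using infsum_wt_odd[OF assms(1-4), of 0] unfolding E_def by (simp add: col_wt_def)
  ultimately have total: "fps_sums (wt x p 0) {l. adm a b l} ((1 + x ^ b) * E 0 False)"
    by (simp add: distrib_right)
  have "?D N * ((1 + x ^ b) * E 0 False) = ?U (Suc N) * ?V N * E (2 * N) False" for N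
  proof -
    have "?D N * ((1 + x ^ b) * E 0 False) = (1 + x ^ b) * (?D N * E 0 False)"
      by (simp only: mult_ac)
    also have "\<dots> = (1 + x ^ b) * ((\<Prod>i<2 * N. 1 + col_wt x p i ^ a * col_wt x p (Suc i) ^ b) * E (2 * N) False)"
      using prod_times_infsum_wt[OF assms(1-4), of "2 * N"]
      by (simp only: prod_col_wt_denominator E_def)
    also have "\<dots> = ?U (Suc N) * ?V N * E (2 * N) False"
      by (simp only: prod_col_wt_numerator[OF assms(5), symmetric] mult.assoc)
    finally show ?thesis .
  qed
  moreover have "(\<lambda>N. ?D N * ((1 + x ^ b) * E 0 False))
      \<longlonglongrightarrow> qpoch_inf (x^2) (p^2) * qpoch_inf (p^2) (p^2) * ((1 + x ^ b) * E 0 False)"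
    by (intro tendsto_fps_mult qpoch_LIMSEQ tendsto_const) (simp_all only: nth_0)
  moreover have "(\<lambda>N. ?U (Suc N) * ?V N * E (2 * N) False)
      \<longlonglongrightarrow> qpoch_inf (-(x^b)) (p^4) * qpoch_inf (-(x^a * p^b)) (p^4) * 1"
  proof (intro tendsto_fps_mult)
    show "(\<lambda>N. ?U (Suc N)) \<longlonglongrightarrow> qpoch_inf (-(x^b)) (p^4)"
      by (rule LIMSEQ_Suc[OF qpoch_LIMSEQ]) (simp_all only: nth_0)
    show "?V \<longlonglongrightarrow> qpoch_inf (-(x^a * p^b)) (p^4)"
      by (rule qpoch_LIMSEQ) (simp_all only: nth_0)
    show "(\<lambda>N. E (2 * N) False) \<longlonglongrightarrow> 1"
      unfolding E_def using LIMSEQ_subseq_LIMSEQ[OF infsum_wt_tendsto_1[OF assms(1,2)], of "\<lambda>N. 2 * N"]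
      by (simp add: o_def strict_mono_def)
  qed
  ultimately have "qpoch_inf (x^2) (p^2) * qpoch_inf (p^2) (p^2) * ((1 + x ^ b) * E 0 False)
      = qpoch_inf (-(x^b)) (p^4) * qpoch_inf (-(x^a * p^b)) (p^4)"
    by (simp only: mult_1_right) (rule LIMSEQ_unique)
  then have "(1 + x ^ b) * E 0 False =
      (qpoch_inf (-(x^b)) (p^4) * qpoch_inf (-(x^a * p^b)) (p^4)) \<oslash> (qpoch_inf (x^2) (p^2) * qpoch_inf (p^2) (p^2))"
    by (intro fps_quot_eqI) (simp_all only: fps_mult_nth_0 qpoch_inf_nth_0 nth_0 mult_ac mult_1)
  then show ?thesis
    using total by simp
qed

section \<open>From column weights to the alternating sum and the two sizes\<close>

definition even_weight :: "nat list \<Rightarrow> nat" where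
  "even_weight l = (\<Sum>i | i < length l \<and> odd i. l ! i)"

text \<open>Removing the first part swaps the parities of all positions, so the two weights recurse
  through each other.\<close>

lemma even_weight_Cons: "even_weight (x # xs) = schmidt_weight xs"
proof -
  have "{i. i < length (x # xs) \<and> odd i} = Suc ` {i. i < length xs \<and> even i}"
    by (auto simp: image_iff less_Suc_eq_0_disj)
  then show ?thesis
    by (simp add: even_weight_def schmidt_weight_def sum.reindex)
qed

lemma schmidt_weight_Cons: "schmidt_weight (x # xs) = x + even_weight xs"
proof -
  have "{i. i < length (x # xs) \<and> even i} = insert 0 (Suc ` {i. i < length xs \<and> odd i})"
    by (auto simp: image_iff less_Suc_eq_0_disj)
  then show ?thesis
    by (simp add: even_weight_def schmidt_weight_def sum.reindex)
qed

lemma weight_Nil [simp]: "even_weight [] = 0" "schmidt_weight [] = 0" "alt_sum [] = 0"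
  by (simp_all add: even_weight_def schmidt_weight_def alt_sum_def)

lemma alt_sum_eq_diff: "alt_sum l = int (schmidt_weight l) - int (even_weight l)"
  by (induction l) (simp_all add: alt_sum_Cons even_weight_Cons schmidt_weight_Cons)

lemma sum_list_eq_add: "sum_list l = schmidt_weight l + even_weight l"
  by (induction l) (simp_all add: even_weight_Cons schmidt_weight_Cons)

text \<open>This and \<open>sum_list_eq\<close> are the source of the substitutions: collecting
  powers of \<open>q\<close> gives \<open>x = z * q\<close>, with \<open>p = q\<close> here and
  \<open>p = q^2\<close> there.\<close>

lemma schmidt_weight_eq: "is_partition l \<Longrightarrow> schmidt_weight l = nat (alt_sum l) + even_weight l"
  using alt_sum_nonneg[of l] alt_sum_eq_diff[of l] by linarith

lemma sum_list_eq: "is_partition l \<Longrightarrow> sum_list l = nat (alt_sum l) + 2 * even_weight l"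
  using schmidt_weight_eq[of l] sum_list_eq_add[of l] by linarith

lemma col_wt_Suc_Suc: "col_wt x p (Suc (Suc i)) = col_wt x p i * p"
  by (simp add: col_wt_def mult_ac)

text \<open>Two further rows on top contribute one factor \<open>p\<close> for each of the
  \<open>head0 l\<close> columns.\<close>

lemma wt_Suc_Suc: "is_partition l \<Longrightarrow> wt x p (Suc (Suc i)) l = wt x p i l * p ^ head0 l"
proof (induction l arbitrary: i)
  case (Cons m l)
  then have "is_partition l" "head0 l \<le> m"
    by (simp_all add: is_partition_Cons)
  then have "p ^ m = p ^ (m - head0 l) * p ^ head0 l"
    by (simp flip: power_add)
  then show ?case
    using Cons.IH[OF \<open>is_partition l\<close>, of "Suc i"]
    by (simp add: col_wt_Suc_Suc power_mult_distrib mult_ac)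
qed simp

text \<open>Parts are removed in pairs: this preserves the signs of the alternating sum, and
  \<open>wt_Suc_Suc\<close> moves the remaining tail back up to level 0.\<close>

lemma wt_0: "is_partition l \<Longrightarrow> wt x p 0 l = x ^ nat (alt_sum l) * p ^ even_weight l"
proof (induction l rule: induct_list012)
  case 1
  then show ?case by simp
next
  case (2 m)
  then show ?case
    by (simp add: col_wt_def alt_sum_Cons even_weight_Cons)
next
  case (3 m n l)
  then have l: "is_partition l" "head0 l \<le> n" "n \<le> m"
    by (simp_all add: is_partition_Cons)
  have "nat (alt_sum (m # n # l)) = (m - n) + nat (alt_sum l)"
    using l alt_sum_nonneg[of l] by (simp add: alt_sum_Cons)
  \<comment> \<open>The second row is split into columns ending there and columns reaching into
    \<open>l\<close>, matching the two powers of \<open>p\<close> below.\<close>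
  moreover have "even_weight (m # n # l) = (n - head0 l) + head0 l + even_weight l"
    using l by (simp add: even_weight_Cons schmidt_weight_Cons)
  moreover have "wt x p 0 (m # n # l) = x ^ (m - n) * (p ^ (n - head0 l) * (wt x p 0 l * p ^ head0 l))"
    using wt_Suc_Suc[OF l(1), of x p 0] by (simp add: col_wt_def)
  ultimately show ?case
    using 3(1) l(1) by (simp only: power_add mult_ac)
qed

section \<open>\<open>P1\<close> and \<open>P2\<close> as sets of admissible lists\<close>

lemma successive_Cons:
  "(\<forall>i. i + 1 < length (x # xs) \<longrightarrow> R ((x # xs) ! i) ((x # xs) ! (i + 1))) \<longleftrightarrow>
     (xs \<noteq> [] \<longrightarrow> R x (head0 xs)) \<and> (\<forall>i. i + 1 < length xs \<longrightarrow> R (xs ! i) (xs ! (i + 1)))"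
  (is "?L \<longleftrightarrow> ?A \<and> ?B")
proof
  assume L: ?L
  have ?A
    using L[THEN spec, of 0] by (cases xs) auto
  moreover have ?B
    using L[THEN spec, of "Suc _"] by auto
  ultimately show "?A \<and> ?B" ..
next
  assume AB: "?A \<and> ?B"
  show ?L
  proof clarify
    fix i assume "i + 1 < length (x # xs)"
    then show "R ((x # xs) ! i) ((x # xs) ! (i + 1))"
      using AB by (cases i; cases xs) auto
  qed
qed

text \<open>An empty tail needs no separate clause, because \<open>head0 [] = 0\<close> is
  even.\<close>

lemma P1_Cons: "x # xs \<in> P1 \<longleftrightarrow> x > 0 \<and> xs \<in> P1 \<and> head0 xs \<le> x \<and> (odd (head0 xs) \<longrightarrow> head0 xs + 3 \<le> x)"
proof -
  have "(xs \<noteq> [] \<longrightarrow> odd (head0 xs) \<longrightarrow> int x - int (head0 xs) \<ge> 3) \<longleftrightarrow> (odd (head0 xs) \<longrightarrow> head0 xs + 3 \<le> x)"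
    by (cases xs) auto
  then show ?thesis
    using successive_Cons[of x xs "\<lambda>m n. odd n \<longrightarrow> int m - int n \<ge> 3"]
    unfolding P1_def mem_Collect_eq is_partition_Cons by blast
qed

text \<open>Over an empty tail, an odd part that is at least 2 is at least 3, so the gap to the
  final 0 is automatically large enough.\<close>

lemma P2_Cons: "x # xs \<in> P2 \<longleftrightarrow> x > 1 \<and> xs \<in> P2 \<and> head0 xs \<le> x \<and> (odd x \<longrightarrow> head0 xs + 3 \<le> x)"
proof -
  have 1: "x \<ge> 2 \<and> (xs \<noteq> [] \<longrightarrow> odd x \<longrightarrow> int x - int (head0 xs) \<ge> 3) \<longleftrightarrow>
      x > 1 \<and> (odd x \<longrightarrow> head0 xs + 3 \<le> x)"
  proof (cases xs)
    case Nil
    have "x \<ge> 2 \<longleftrightarrow> x > 1 \<and> (odd x \<longrightarrow> 3 \<le> x)"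
      by presburger
    then show ?thesis
      using Nil by simp
  qed auto
  have 2: "(\<forall>y\<in>set (x # xs). y \<ge> 2) \<longleftrightarrow> x \<ge> 2 \<and> (\<forall>y\<in>set xs. y \<ge> 2)" "x \<ge> 2 \<Longrightarrow> x > 0"
    by auto
  show ?thesis
    using successive_Cons[of x xs "\<lambda>m n. odd m \<longrightarrow> int m - int n \<ge> 3"] 1 2
    unfolding P2_def mem_Collect_eq is_partition_Cons by blast
qed

text \<open>The parities of two neighbours fix the parity of their gap, so a gap of at least 3
  between odd parts is at least \<open>3 + 1\<close>. The other minima are 3 for even above odd, 1
  for odd above even and 0 for even above even; larger gaps exceed the minimum by an even
  surplus.\<close>

lemma P1_eq_adm: "P1 = {l. adm 3 1 l}"
proof -
  have "l \<in> P1 \<longleftrightarrow> adm 3 1 l" for l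
  proof (induction l)
    case Nil
    show ?case by (simp add: P1_def is_partition_def)
  next
    case (Cons x xs)
    have "(h \<le> x \<and> (odd h \<longrightarrow> h + 3 \<le> x)) \<longleftrightarrow>
        (\<exists>k. h + 2 * k + (if odd h then 3 else 0) + (if odd x then 1 else 0) = x)" for h :: nat
      by presburger
    then show ?case
      unfolding P1_Cons adm.simps(2) Cons by blast
  qed
  then show ?thesis by blast
qed

text \<open>Now the minima are 1 for even above odd and 3 for odd above even; the latter, applied to
  the final 0, excludes the part 1.\<close>

lemma P2_eq_adm: "P2 = {l. adm 1 3 l}"
proof -
  have "l \<in> P2 \<longleftrightarrow> adm 1 3 l" for l
  proof (induction l)
    case Nil
    show ?case by (simp add: P2_def is_partition_def)
  next
    case (Cons x xs)
    have "(x > 1 \<and> h \<le> x \<and> (odd x \<longrightarrow> h + 3 \<le> x)) \<longleftrightarrow>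
        (x > 0 \<and> (\<exists>k. h + 2 * k + (if odd h then 1 else 0) + (if odd x then 3 else 0) = x))" for h :: nat
      by presburger
    then show ?case
      unfolding P2_Cons adm.simps(2) Cons by blast
  qed
  then show ?thesis by blast
qed

section \<open>The four identities\<close>

text \<open>\<open>f\<close>, \<open>A\<close>, \<open>B\<close> and \<open>R\<close> enter through
  equations, so each case only has to match its explicit formulas. Stating \<open>A\<close> at
  \<open>Suc n\<close> removes the truncated \<open>n - 1\<close>.\<close>

lemma adm_series_product:
  fixes x p :: "'a::comm_ring_1 fps" and a b :: nat and f :: "nat list \<Rightarrow> 'a fps" and A B :: "nat \<Rightarrow> 'a fps"
  assumes "x $ 0 = 0" "p $ 0 = 0" "odd a" "odd b" "a + b = 4"
  assumes f: "\<And>l. is_partition l \<Longrightarrow> f l = x ^ nat (alt_sum l) * p ^ even_weight l"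
  assumes A: "\<And>n. A (Suc n) = ((p^(2*n+2) + x^a * p^b * p^(4*n)) * qpoch (-(x^b)) (p^4) (Suc n) * qpoch (-(x^a * p^b)) (p^4) n)
              \<oslash> (qpoch (p^2) (p^2) (Suc n) * qpoch (x^2) (p^2) (Suc n))"
    and B: "\<And>n. B n = ((x^2 * p^(2*n) + x^b * p^(4*n)) * qpoch (-(x^b)) (p^4) n * qpoch (-(x^a * p^b)) (p^4) n)
              \<oslash> (qpoch (p^2) (p^2) n * qpoch (x^2) (p^2) (n+1))"
  assumes R: "R = (qpoch_inf (-(x^b)) (p^4) * qpoch_inf (-(x^a * p^b)) (p^4))
              \<oslash> (qpoch_inf (x^2) (p^2) * qpoch_inf (p^2) (p^2))"
  shows "f summable_on {l. adm a b l} \<and> A summable_on {1..} \<and> B summable_on UNIV \<and>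
    (\<Sum>\<^sub>\<infinity>l\<in>{l. adm a b l}. f l) = 1 + (\<Sum>\<^sub>\<infinity>n\<in>{1..}. A n) + (\<Sum>\<^sub>\<infinity>n. B n) \<and>
    1 + (\<Sum>\<^sub>\<infinity>n\<in>{1..}. A n) + (\<Sum>\<^sub>\<infinity>n. B n) = R"
proof -
  let ?u = "x^b" and ?v = "x^a * p^b"
  let ?A = "\<lambda>n. ((p^(2*n) + ?v * p^(4*(n-1))) * qpoch (-?u) (p^4) n * qpoch (-?v) (p^4) (n-1))
              \<oslash> (qpoch (p^2) (p^2) n * qpoch (x^2) (p^2) n)"
    and ?B = "\<lambda>n. ((x^2 * p^(2*n) + ?u * p^(4*n)) * qpoch (-?u) (p^4) n * qpoch (-?v) (p^4) n)
              \<oslash> (qpoch (p^2) (p^2) n * qpoch (x^2) (p^2) (n+1))"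
  have uv: "?u $ 0 = 0" "?v $ 0 = 0"
    using assms(1-4) by (simp_all add: fps_power_zeroth zero_power odd_pos)
  have "A n = ?A n" if n: "n \<in> {1..}" for n
  proof -
    obtain m where m: "n = Suc m"
      using n by (cases n) auto
    have "2 * Suc m = 2 * m + 2"
      by simp
    then show ?thesis
      unfolding m A by (simp only: diff_Suc_1)
  qed
  then have eqA: "A summable_on {1..} \<longleftrightarrow> ?A summable_on {1..}" "infsum A {1..} = infsum ?A {1..}"
    using summable_on_cong[of "{1..}" A ?A] infsum_cong[of "{1..}" A ?A] by blast+
  have "B = ?B"
    by (rule ext) (rule B)
  have "fps_sums f {l. adm a b l} R"
    using fps_sums_adm[OF assms(1-5)] unfolding R
    by (rule iffD1[OF fps_sums_cong, rotated]) (use adm_imp_is_partition f in \<open>simp add: wt_0\<close>)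
  then have "f summable_on {l. adm a b l}" "infsum f {l. adm a b l} = R"
    using fps_sums_imp_has_sum has_sum_imp_summable fps_sums_imp_infsum by blast+
  then show ?thesis
    using telescoping_series[OF assms(1,2) uv] unfolding eqA \<open>B = ?B\<close> R by simp
qed

theorem theorem7p7:
  fixes q z :: "int poly fps"
  defines "q \<equiv> fps_X" and "z \<equiv> fps_const [:0, 1:]"
  defines "G \<equiv> (\<lambda>l. z ^ nat (alt_sum l) * q ^ sum_list l)"
    and "H \<equiv> (\<lambda>l. z ^ nat (alt_sum l) * q ^ schmidt_weight l)"
  defines "A1 \<equiv> (\<lambda>n. (q^(4*n) * qpoch (-(z * q)) (q^8) n * qpoch (-(z^3 * q^5)) (q^8) (n-1) * (1 + z^3 * q^(4*n-3)))
              \<oslash> (qpoch (q^4) (q^4) n * qpoch (z^2 * q^2) (q^4) n))"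
    and "B1 \<equiv> (\<lambda>n. ((z^2 * q^(4*n+2) + z * q^(8*n+1)) * qpoch (-(z * q)) (q^8) n * qpoch (-(z^3 * q^5)) (q^8) n)
              \<oslash> (qpoch (q^4) (q^4) n * qpoch (z^2 * q^2) (q^4) (n+1)))"
  defines "A2 \<equiv> (\<lambda>n. (q^(4*n) * qpoch (-(z^3 * q^3)) (q^8) n * qpoch (-(z * q^7)) (q^8) (n-1) * (1 + z * q^(4*n-1)))
              \<oslash> (qpoch (q^4) (q^4) n * qpoch (z^2 * q^2) (q^4) n))"
    and "B2 \<equiv> (\<lambda>n. (z^2 * q^(4*n+2) * (1 + z * q^(4*n+1)) * qpoch (-(z^3 * q^3)) (q^8) n * qpoch (-(z * q^7)) (q^8) n)
              \<oslash> (qpoch (q^4) (q^4) n * qpoch (z^2 * q^2) (q^4) (n+1)))"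
  defines "A3 \<equiv> (\<lambda>n. (q^(2*n) * qpoch (-(z * q)) (q^4) n * qpoch (-(z^3 * q^4)) (q^4) (n-1) * (1 + z^3 * q^(2*n)))
              \<oslash> (qpoch (q^2) (q^2) n * qpoch (z^2 * q^2) (q^2) n))"
    and "B3 \<equiv> (\<lambda>n. ((z^2 * q^(2*n+2) + z * q^(4*n+1)) * qpoch (-(z * q)) (q^4) n * qpoch (-(z^3 * q^4)) (q^4) n)
              \<oslash> (qpoch (q^2) (q^2) n * qpoch (z^2 * q^2) (q^2) (n+1)))"
  defines "A4 \<equiv> (\<lambda>n. (q^(2*n) * qpoch (-(z^3 * q^3)) (q^4) n * qpoch (-(z * q^4)) (q^4) (n-1) * (1 + z * q^(2*n)))
              \<oslash> (qpoch (q^2) (q^2) n * qpoch (z^2 * q^2) (q^2) n))"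
    and "B4 \<equiv> (\<lambda>n. (z^2 * q^(2*n+2) * (1 + z * q^(2*n+1)) * qpoch (-(z^3 * q^3)) (q^4) n * qpoch (-(z * q^4)) (q^4) n)
              \<oslash> (qpoch (q^2) (q^2) n * qpoch (z^2 * q^2) (q^2) (n+1)))"
  shows "(G summable_on P1 \<and> A1 summable_on {1..} \<and> B1 summable_on UNIV \<and>
       (\<Sum>\<^sub>\<infinity>l\<in>P1. G l) = 1 + (\<Sum>\<^sub>\<infinity>n\<in>{1..}. A1 n) + (\<Sum>\<^sub>\<infinity>n. B1 n) \<and>
       1 + (\<Sum>\<^sub>\<infinity>n\<in>{1..}. A1 n) + (\<Sum>\<^sub>\<infinity>n. B1 n) =
         (qpoch_inf (-(z * q)) (q^8) * qpoch_inf (-(z^3 * q^5)) (q^8))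
           \<oslash> (qpoch_inf (z^2 * q^2) (q^4) * qpoch_inf (q^4) (q^4))) \<and>
    (G summable_on P2 \<and> A2 summable_on {1..} \<and> B2 summable_on UNIV \<and>
       (\<Sum>\<^sub>\<infinity>l\<in>P2. G l) = 1 + (\<Sum>\<^sub>\<infinity>n\<in>{1..}. A2 n) + (\<Sum>\<^sub>\<infinity>n. B2 n) \<and>
       1 + (\<Sum>\<^sub>\<infinity>n\<in>{1..}. A2 n) + (\<Sum>\<^sub>\<infinity>n. B2 n) =
         (qpoch_inf (-(z^3 * q^3)) (q^8) * qpoch_inf (-(z * q^7)) (q^8))
           \<oslash> (qpoch_inf (z^2 * q^2) (q^4) * qpoch_inf (q^4) (q^4))) \<and>
    (H summable_on P1 \<and> A3 summable_on {1..} \<and> B3 summable_on UNIV \<and>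
       (\<Sum>\<^sub>\<infinity>l\<in>P1. H l) = 1 + (\<Sum>\<^sub>\<infinity>n\<in>{1..}. A3 n) + (\<Sum>\<^sub>\<infinity>n. B3 n) \<and>
       1 + (\<Sum>\<^sub>\<infinity>n\<in>{1..}. A3 n) + (\<Sum>\<^sub>\<infinity>n. B3 n) =
         (qpoch_inf (-(z * q)) (q^4) * qpoch_inf (-(z^3 * q^4)) (q^4))
           \<oslash> (qpoch_inf (z^2 * q^2) (q^2) * qpoch_inf (q^2) (q^2))) \<and>
    (H summable_on P2 \<and> A4 summable_on {1..} \<and> B4 summable_on UNIV \<and>
       (\<Sum>\<^sub>\<infinity>l\<in>P2. H l) = 1 + (\<Sum>\<^sub>\<infinity>n\<in>{1..}. A4 n) + (\<Sum>\<^sub>\<infinity>n. B4 n) \<and>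
       1 + (\<Sum>\<^sub>\<infinity>n\<in>{1..}. A4 n) + (\<Sum>\<^sub>\<infinity>n. B4 n) =
         (qpoch_inf (-(z^3 * q^3)) (q^4) * qpoch_inf (-(z * q^4)) (q^4))
           \<oslash> (qpoch_inf (z^2 * q^2) (q^2) * qpoch_inf (q^2) (q^2)))"
proof -
  have nth_0: "(z * q) $ 0 = 0" "q $ 0 = 0" "q^2 $ 0 = 0"
    by (simp_all add: q_def power2_eq_square)
  \<comment> \<open>Values of \<open>x^b\<close> and \<open>x^a * p^b\<close> for both pairs
    \<open>(a, b)\<close>, with \<open>x = z * q\<close> and \<open>p = q^2\<close> or
    \<open>p = q\<close>.\<close>
  have pw: "(z * q)^1 = z * q" "(z * q)^2 = z^2 * q^2" "(z * q)^3 = z^3 * q^3"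
    "q^1 = q" "(q^2)^1 = q^2" "(q^2)^2 = q^4" "(q^2)^3 = q^6" "(q^2)^4 = q^8"
    "z^3 * q^3 * q^2 = z^3 * q^5" "z * q * q^6 = z * q^7"
    "z^3 * q^3 * q = z^3 * q^4" "z * q * q^3 = z * q^4"
    by (simp_all add: power_mult_distrib eval_nat_numeral mult_ac)
  have G: "G l = (z * q) ^ nat (alt_sum l) * (q^2) ^ even_weight l" if "is_partition l" for l
    unfolding G_def sum_list_eq[OF that] by (simp only: power_mult_distrib power_add power_mult mult.assoc)
  have H: "H l = (z * q) ^ nat (alt_sum l) * q ^ even_weight l" if "is_partition l" for l
    unfolding H_def schmidt_weight_eq[OF that] by (simp add: power_mult_distrib power_add mult_ac)
  have odd: "odd (3::nat)" "odd (1::nat)" "3 + 1 = (4::nat)" "1 + 3 = (4::nat)"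
    by simp_all
  note P1G = adm_series_product[OF nth_0(1,3) odd(1,2,3) G, unfolded pw, folded P1_eq_adm]
  note P2G = adm_series_product[OF nth_0(1,3) odd(2,1,4) G, unfolded pw, folded P2_eq_adm]
  note P1H = adm_series_product[OF nth_0(1,2) odd(1,2,3) H, unfolded pw, folded P1_eq_adm]
  note P2H = adm_series_product[OF nth_0(1,2) odd(2,1,4) H, unfolded pw, folded P2_eq_adm]
  have e: "4 * Suc n - 3 = 4 * n + 1" "4 * Suc n - 1 = 4 * n + 3" for n
    by simp_all
  \<comment> \<open>The numerators of \<open>A1\<close>, \<open>B1\<close>, ..., \<open>A4\<close>,
    \<open>B4\<close> in this order. In \<open>B1\<close> and \<open>B3\<close> the negative powers
    are already multiplied out: \<open>z * q^(8*n+1)\<close> is \<open>z^2 * q^(4*n+2)\<close> times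
    \<open>z^(-1) * q^(4*n-1)\<close>.\<close>
  have num: "q^(4 * Suc n) * U * V * (1 + z^3 * q^(4 * Suc n - 3)) = ((q^2)^(2*n+2) + z^3 * q^5 * (q^2)^(4*n)) * U * V"
    "(z^2 * q^(4*n+2) + z * q^(8*n+1)) * U * V = (z^2 * q^2 * (q^2)^(2*n) + z * q * (q^2)^(4*n)) * U * V"
    "q^(4 * Suc n) * U * V * (1 + z * q^(4 * Suc n - 1)) = ((q^2)^(2*n+2) + z * q^7 * (q^2)^(4*n)) * U * V"
    "z^2 * q^(4*n+2) * (1 + z * q^(4*n+1)) * U * V = (z^2 * q^2 * (q^2)^(2*n) + z^3 * q^3 * (q^2)^(4*n)) * U * V"
    "q^(2 * Suc n) * U * V * (1 + z^3 * q^(2 * Suc n)) = (q^(2*n+2) + z^3 * q^4 * q^(4*n)) * U * V"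
    "(z^2 * q^(2*n+2) + z * q^(4*n+1)) * U * V = (z^2 * q^2 * q^(2*n) + z * q * q^(4*n)) * U * V"
    "q^(2 * Suc n) * U * V * (1 + z * q^(2 * Suc n)) = (q^(2*n+2) + z * q^4 * q^(4*n)) * U * V"
    "z^2 * q^(2*n+2) * (1 + z * q^(2*n+1)) * U * V = (z^2 * q^2 * q^(2*n) + z^3 * q^3 * q^(4*n)) * U * V"
    for n U V
    unfolding e by (simp_all add: power_add power_mult mult_Suc_right eval_nat_numeral algebra_simps)
  show ?thesis
    by (intro conjI[OF P1G conjI[OF P2G conjI[OF P1H P2H]]])
      (simp_all only: A1_def A2_def A3_def A4_def B1_def B2_def B3_def B4_def num diff_Suc_1)
qed

end
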